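(* Let $\mathcal{B}$ be a complex unital Banach algebra with identity $I \neq 0$, let $n \geq 1$, and let $A = (A_0, A_1, \dots, A_n)$ be any $(n+1)$-tuple of elements of $\mathcal{B}$ (not assumed to commute). Then the projective spectrum $p(A)$ is a nonempty compact subset of $\mathbb{P}^n$.
   Context: For $z = (z_0, \dots, z_n) \in \mathbb{C}^{n+1}$ put $A(z) = z_0A_0 + z_1A_1 + \cdots + z_nA_n \in \mathcal{B}$. $\mathbb{P}^n = (\mathbb{C}^{n+1}\setminus\{0\})/\mathbb{C}^{\times}$ is complex projective space with the quotient topology. The projective spectrum is $p(A) = \{[z_0, z_1, \dots, z_n] \in \mathbb{P}^n : A(z) \text{ is not invertible in } \mathcal{B}\}$ (well defined, since invertibility of $A(z)$ is unchanged under scaling $z$ by a nonzero complex number). *)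

theory Defs
  imports "HOL-Analysis.Analysis"
begin

(* Complex unital Banach algebras.  The unit is only required to differ from 0
   (zero_neq_one is part of real_algebra_1); norm 1 = 1 is not assumed.  The real
   scalar multiplication underlying the library's normed-algebra classes is the
   restriction of the complex one. *)

class complex_banach_algebra = real_normed_algebra + real_algebra_1 + banach +
  fixes scaleC :: "complex \<Rightarrow> 'a \<Rightarrow> 'a" (infixr "*\<^sub>C" 75)
  assumes scaleC_add_right: "c *\<^sub>C (x + y) = c *\<^sub>C x + c *\<^sub>C y"
    and scaleC_add_left: "(c + d) *\<^sub>C x = c *\<^sub>C x + d *\<^sub>C x"
    and scaleC_scaleC: "c *\<^sub>C d *\<^sub>C x = (c * d) *\<^sub>C x"
    and scaleC_one: "1 *\<^sub>C x = x"
    and mult_scaleC_left: "(c *\<^sub>C x) * y = c *\<^sub>C (x * y)"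
    and mult_scaleC_right: "x * (c *\<^sub>C y) = c *\<^sub>C (x * y)"
    and norm_scaleC: "norm (c *\<^sub>C x) = norm c * norm x"
    and scaleR_scaleC: "r *\<^sub>R x = complex_of_real r *\<^sub>C x"

definition has_inverse :: "'a::monoid_mult \<Rightarrow> bool"
  where "has_inverse x \<longleftrightarrow> (\<exists>y. x * y = 1 \<and> y * x = 1)"

(* Projective space of complex ^ 'm, that is, P^n for CARD('m) = n + 1, as the
   quotient of the nonzero vectors. *)

definition proj_rel :: "complex ^ 'm \<Rightarrow> complex ^ 'm \<Rightarrow> bool"
  where "proj_rel z w \<longleftrightarrow> z \<noteq> 0 \<and> w \<noteq> 0 \<and> (\<exists>c. c \<noteq> 0 \<and> w = c *s z)"

lemma part_equivp_proj_rel: "part_equivp proj_rel"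
proof (rule part_equivpI)
  have "proj_rel (axis undefined 1) (axis undefined 1 :: complex ^ 'm)"
    unfolding proj_rel_def by (auto simp: axis_eq_0_iff intro!: exI[of _ 1])
  then show "\<exists>z :: complex ^ 'm. proj_rel z z"
    by blast
  show "symp (proj_rel :: complex ^ 'm \<Rightarrow> _)"
  proof (rule sympI)
    fix z w :: "complex ^ 'm"
    assume "proj_rel z w"
    then obtain c where "z \<noteq> 0" "w \<noteq> 0" "c \<noteq> 0" "w = c *s z"
      unfolding proj_rel_def by blast
    then show "proj_rel w z"
      unfolding proj_rel_def by (auto simp: vector_smult_assoc intro!: exI[of _ "inverse c"])
  qed
  show "transp (proj_rel :: complex ^ 'm \<Rightarrow> _)"
  proof (rule transpI)
    fix u v w :: "complex ^ 'm"
    assume "proj_rel u v" "proj_rel v w"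
    then obtain c d where "u \<noteq> 0" "w \<noteq> 0" "c \<noteq> 0" "d \<noteq> 0" "v = c *s u" "w = d *s v"
      unfolding proj_rel_def by blast
    then have "d * c \<noteq> 0" "w = (d * c) *s u"
      by (simp_all add: vector_smult_assoc)
    with \<open>u \<noteq> 0\<close> \<open>w \<noteq> 0\<close> show "proj_rel u w"
      unfolding proj_rel_def by blast
  qed
qed

quotient_type 'm projective_space = "complex ^ ('m::finite)" / partial: proj_rel
  by (rule part_equivp_proj_rel)

(* The class [z] of z; meaningful only for z \<noteq> 0. *)
definition proj_class :: "complex ^ 'm \<Rightarrow> 'm projective_space"
  where "proj_class = abs_projective_space"

lemma proj_class_eq_iff:
  assumes "z \<noteq> 0" "w \<noteq> 0"
  shows "proj_class z = proj_class w \<longleftrightarrow> (\<exists>c. c \<noteq> 0 \<and> w = c *s z)"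
proof -
  have refl: "proj_rel v v" if "v \<noteq> 0" for v :: "complex ^ 'm"
    using that unfolding proj_rel_def by (auto intro!: exI[of _ 1])
  show ?thesis
    using Quotient_rel[OF Quotient_projective_space, of z w] refl assms
    unfolding proj_class_def by (auto simp: proj_rel_def)
qed

lemma proj_class_surj: "\<exists>z. z \<noteq> 0 \<and> proj_class z = p"
  by (metis Quotient_abs_rep[OF Quotient_projective_space]
      Quotient_rep_reflp[OF Quotient_projective_space] proj_class_def proj_rel_def)

instantiation projective_space :: (finite) topological_space
begin

definition open_projective_space :: "'a projective_space set \<Rightarrow> bool"
  where "open_projective_space U \<longleftrightarrow>
    openin (top_of_set (- {0})) {z \<in> - {0}. proj_class z \<in> U}"

instance
proof
  have "{z \<in> - {0 :: complex ^ 'a}. proj_class z \<in> UNIV} = - {0}"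
    by auto
  then show "open (UNIV :: 'a projective_space set)"
    unfolding open_projective_space_def by (simp only: openin_subtopology_self)
next
  fix S T :: "'a projective_space set"
  assume "open S" "open T"
  moreover have "{z \<in> - {0}. proj_class z \<in> S \<inter> T} =
      {z \<in> - {0}. proj_class z \<in> S} \<inter> {z \<in> - {0}. proj_class z \<in> T}"
    by auto
  ultimately show "open (S \<inter> T)"
    unfolding open_projective_space_def by (simp only: openin_Int)
next
  fix K :: "'a projective_space set set"
  assume "\<forall>S\<in>K. open S"
  moreover have "{z \<in> - {0}. proj_class z \<in> \<Union>K} =
      \<Union> ((\<lambda>S. {z \<in> - {0}. proj_class z \<in> S}) ` K)"
    by auto
  ultimately show "open (\<Union>K)"
    unfolding open_projective_space_def by (auto simp only: intro!: openin_Union)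
qed

end

lemma quotient_map_proj_class:
  "quotient_map (top_of_set (- {0})) euclidean (proj_class :: complex ^ 'm \<Rightarrow> _)"
proof -
  have "proj_class ` (- {0 :: complex ^ 'm}) = UNIV"
  proof (intro equalityI subsetI UNIV_I)
    fix p :: "'m projective_space"
    obtain z where "z \<noteq> 0" "proj_class z = p"
      using proj_class_surj by blast
    then show "p \<in> proj_class ` (- {0})"
      by blast
  qed
  then show ?thesis
    unfolding quotient_map_def by (simp add: open_projective_space_def del: Compl_iff)
qed

definition linear_pencil :: "'b::complex_banach_algebra ^ 'm \<Rightarrow> complex ^ 'm \<Rightarrow> 'b"
  where "linear_pencil A z = (\<Sum>i\<in>UNIV. z $ i *\<^sub>C A $ i)"

definition projective_spectrum ::
    "'b::complex_banach_algebra ^ 'm \<Rightarrow> 'm projective_space set"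
  where "projective_spectrum A =
    {proj_class z | z. z \<noteq> 0 \<and> \<not> has_inverse (linear_pencil A z)}"

lemma scaleC_zero_right: "c *\<^sub>C (0 :: 'b::complex_banach_algebra) = 0"
  using scaleC_add_right[of c 0 "0 :: 'b"] by simp

lemma linear_pencil_scale:
  fixes A :: "'b::complex_banach_algebra ^ 'm"
  shows "linear_pencil A (c *s z) = c *\<^sub>C linear_pencil A z"
proof -
  have "c *\<^sub>C sum f S = (\<Sum>i\<in>S. c *\<^sub>C f i)"
    for f :: "'m \<Rightarrow> 'b" and S
    by (induction S rule: infinite_finite_induct)
      (simp_all add: scaleC_zero_right scaleC_add_right)
  then show ?thesis
    unfolding linear_pencil_def by (simp add: scaleC_scaleC)
qed

lemma has_inverse_scaleC:
  assumes "has_inverse (x :: 'b::complex_banach_algebra)" "c \<noteq> 0"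
  shows "has_inverse (c *\<^sub>C x)"
proof -
  obtain y where "x * y = 1" "y * x = 1"
    using assms(1) unfolding has_inverse_def by blast
  then have "c *\<^sub>C x * (inverse c *\<^sub>C y) = 1" "(inverse c *\<^sub>C y) * c *\<^sub>C x = 1"
    using assms(2) by (simp_all add: mult_scaleC_left mult_scaleC_right scaleC_scaleC scaleC_one)
  then show ?thesis
    unfolding has_inverse_def by blast
qed

lemma proj_class_in_projective_spectrum_iff:
  assumes "z \<noteq> 0"
  shows "proj_class z \<in> projective_spectrum A \<longleftrightarrow> \<not> has_inverse (linear_pencil A z)"
proof
  assume "proj_class z \<in> projective_spectrum A"
  then obtain w where "w \<noteq> 0" "proj_class z = proj_class w" "\<not> has_inverse (linear_pencil A w)"
    unfolding projective_spectrum_def by blast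
  then obtain c where "c \<noteq> 0" "w = c *s z"
    using proj_class_eq_iff[OF assms] by blast
  with \<open>\<not> has_inverse (linear_pencil A w)\<close> show "\<not> has_inverse (linear_pencil A z)"
    using has_inverse_scaleC[of "linear_pencil A z" c] by (auto simp: linear_pencil_scale)
next
  assume "\<not> has_inverse (linear_pencil A z)"
  with assms show "proj_class z \<in> projective_spectrum A"
    unfolding projective_spectrum_def by blast
qed

end

(* Compactness: the spectrum is the image of the unit vectors z with A(z) singular, a closed
   set since the invertible elements form an open set.  Nonemptiness: were A(z) invertible for
   all nonzero z, then A_i^{-1} A_j would have empty spectrum for i different from j.  That
   spectra are nonempty is shown by Rickart's argument, which needs neither functionals nor
   integration: if 1 - ca is invertible for every complex c, the averages of the continuous
   function (1 - ca)^{-1} over the n-th roots of unity, which equal (1 - (ca)^n)^{-1}, are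
   equicontinuous in c, uniformly in n.  This makes the set of all r with ||(ra)^n|| < 1 for
   some n > 0 closed as well as open in [0, oo), although ||a^{-1}|| does not belong to it. *)

theory Submission
  imports Defs
begin

section \<open>Arithmetic of the complex scalar multiplication\<close>

lemma scaleC_zero_left: "0 *\<^sub>C (x :: 'b::complex_banach_algebra) = 0"
  using scaleC_add_left[of 0 0 x] by simp

lemma scaleC_minus_left: "(- c) *\<^sub>C (x :: 'b::complex_banach_algebra) = - (c *\<^sub>C x)"
  using scaleC_add_left[of c "- c" x] by (simp add: scaleC_zero_left eq_neg_iff_add_eq_0 add.commute)

lemma scaleC_minus_right: "c *\<^sub>C (- x :: 'b::complex_banach_algebra) = - (c *\<^sub>C x)"
  using scaleC_add_right[of c x "- x"]
  by (simp add: scaleC_zero_right eq_neg_iff_add_eq_0 add.commute)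

lemma scaleC_diff_left: "(c - d) *\<^sub>C (x :: 'b::complex_banach_algebra) = c *\<^sub>C x - d *\<^sub>C x"
  using scaleC_add_left[of c "- d" x] by (simp add: scaleC_minus_left)

lemma scaleC_diff_right: "c *\<^sub>C (x - y :: 'b::complex_banach_algebra) = c *\<^sub>C x - c *\<^sub>C y"
  using scaleC_add_right[of c x "- y"] by (simp add: scaleC_minus_right)

lemma scaleC_sum_left: "sum f S *\<^sub>C (x :: 'b::complex_banach_algebra) = (\<Sum>i\<in>S. f i *\<^sub>C x)"
  by (induction S rule: infinite_finite_induct) (simp_all add: scaleC_zero_left scaleC_add_left)

lemma power_scaleC: "(c *\<^sub>C (x :: 'b::complex_banach_algebra)) ^ n = c ^ n *\<^sub>C x ^ n"
  by (induction n)
    (simp_all add: scaleC_one mult_scaleC_left mult_scaleC_right scaleC_scaleC mult.commute)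

lemma bounded_linear_scaleC_left: "bounded_linear (\<lambda>c. c *\<^sub>C (x :: 'b::complex_banach_algebra))"
  by (rule bounded_linear_intro[of _ "norm x"])
    (simp_all add: scaleC_add_left norm_scaleC scaleR_scaleC scaleC_scaleC scaleR_conv_of_real)

section \<open>Norms and limits of powers\<close>

lemma norm_one_ge_1: "1 \<le> norm (1 :: 'b::complex_banach_algebra)"
proof -
  have "norm (1 :: 'b) \<le> norm (1 :: 'b) * norm (1 :: 'b)"
    using norm_mult_ineq[of "1 :: 'b" 1] by simp
  moreover have "norm (1 :: 'b) > 0"
    by simp
  ultimately show ?thesis
    by (metis mult_le_cancel_left1 not_less_iff_gr_or_eq order_less_imp_le)
qed

text \<open>Submultiplicativity gives this by induction starting from exponent 1. Exponent 0 has to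
  be left out, since the norm of the unit may exceed 1.\<close>

lemma norm_power_Suc_le: "norm ((x :: 'b::complex_banach_algebra) ^ Suc n) \<le> norm x ^ Suc n"
proof (induction n)
  case (Suc n)
  have "norm (x ^ Suc (Suc n)) \<le> norm x * norm (x ^ Suc n)"
    unfolding power_Suc[of x "Suc n"] by (rule norm_mult_ineq)
  also have "\<dots> \<le> norm x ^ Suc (Suc n)"
    unfolding power_Suc[of "norm x" "Suc n"] by (intro mult_left_mono Suc.IH norm_ge_zero)
  finally show ?case .
qed simp

lemma norm_power_le:
  assumes "n > 0"
  shows "norm ((x :: 'b::complex_banach_algebra) ^ n) \<le> norm x ^ n"
  using assms norm_power_Suc_le[of x "n - 1"] by simp

lemma tendsto_power_zero_of_norm_less_1:
  fixes x :: "'b::complex_banach_algebra"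
  assumes "norm x < 1"
  shows "(\<lambda>n. x ^ n) \<longlonglongrightarrow> 0"
proof (rule tendsto_0_le[where K = 1])
  show "(\<lambda>n. norm x ^ n) \<longlonglongrightarrow> 0"
    using assms by (intro LIMSEQ_power_zero) simp
  show "\<forall>\<^sub>F n in sequentially. norm (x ^ n) \<le> norm (norm x ^ n) * 1"
    using eventually_gt_at_top[of 0] by eventually_elim (simp add: norm_power_le)
qed

text \<open>Division with remainder splits \<open>x ^ m\<close> into a power of
  \<open>x ^ n\<close>, which tends to 0 as the quotient grows, and one of finitely many factors
  \<open>x ^ r\<close> with \<open>r < n\<close>, whose norms have the common bound
  \<open>K\<close>.\<close>

lemma tendsto_power_zero_of_norm_power_less_1:
  fixes x :: "'b::complex_banach_algebra"
  assumes "n > 0" "norm (x ^ n) < 1"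
  shows "(\<lambda>m. x ^ m) \<longlonglongrightarrow> 0"
proof (rule tendsto_0_le)
  define K where "K = (\<Sum>r<n. norm (x ^ r))"
  show "(\<lambda>m. (x ^ n) ^ (m div n)) \<longlonglongrightarrow> 0"
    using tendsto_power_zero_of_norm_less_1[OF assms(2)]
      filterlim_at_top_div_const_nat[OF assms(1)]
    by (rule filterlim_compose)
  show "\<forall>\<^sub>F m in sequentially. norm (x ^ m) \<le> norm ((x ^ n) ^ (m div n)) * K"
  proof (rule always_eventually, rule allI)
    fix m
    have "x ^ m = (x ^ n) ^ (m div n) * x ^ (m mod n)"
      by (simp flip: power_mult power_add)
    then have "norm (x ^ m) \<le> norm ((x ^ n) ^ (m div n)) * norm (x ^ (m mod n))"
      by (simp add: norm_mult_ineq)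
    also have "norm (x ^ (m mod n)) \<le> K"
      unfolding K_def using assms(1) by (intro member_le_sum) auto
    finally show "norm (x ^ m) \<le> norm ((x ^ n) ^ (m div n)) * K"
      by (simp add: mult_left_mono)
  qed
qed

section \<open>Invertible elements\<close>

lemma has_inverse_mult:
  assumes "has_inverse (x :: 'a::monoid_mult)" "has_inverse y"
  shows "has_inverse (x * y)"
proof -
  obtain u v where "x * u = 1" "u * x = 1" "y * v = 1" "v * y = 1"
    using assms unfolding has_inverse_def by blast
  then have "(x * y) * (v * u) = 1" "(v * u) * (x * y) = 1"
    by (metis mult.assoc mult_1_right)+
  then show ?thesis
    unfolding has_inverse_def by blast
qed

text \<open>Neumann series: multiplying the sum of the powers of \<open>x\<close> by
  \<open>1 - x\<close> on either side gives a telescoping series with sum 1.\<close>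

lemma has_inverse_one_minus:
  fixes x :: "'b::complex_banach_algebra"
  assumes "norm x < 1"
  shows "has_inverse (1 - x)"
proof -
  have "summable (\<lambda>n. norm x ^ Suc n)"
    using assms by (subst summable_Suc_iff) (simp add: summable_geometric)
  then have "summable (\<lambda>n. x ^ Suc n)"
    by (rule summable_comparison_test'[where N = 0]) (rule norm_power_Suc_le)
  then have sm: "summable (\<lambda>n. x ^ n)"
    by (subst (asm) summable_Suc_iff)
  have x0: "(\<lambda>n. x ^ n) \<longlonglongrightarrow> 0"
    using assms by (rule tendsto_power_zero_of_norm_less_1)
  have tel: "(\<lambda>n. x ^ n - x ^ Suc n) sums 1"
    using telescope_sums'[OF x0] by simp
  have "(\<lambda>n. (1 - x) * x ^ n) sums ((1 - x) * (\<Sum>n. x ^ n))"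
    using sm by (intro sums_mult summable_sums)
  then have "(1 - x) * (\<Sum>n. x ^ n) = 1"
    using tel by (intro sums_unique2) (simp_all add: algebra_simps)
  moreover have "(\<lambda>n. x ^ n * (1 - x)) sums ((\<Sum>n. x ^ n) * (1 - x))"
    using sm by (intro sums_mult2 summable_sums)
  then have "(\<Sum>n. x ^ n) * (1 - x) = 1"
    using tel by (intro sums_unique2) (simp_all add: algebra_simps power_commutes)
  ultimately show ?thesis
    unfolding has_inverse_def by blast
qed

text \<open>Near an invertible \<open>x\<close> with inverse \<open>y\<close>, an element factors as
  \<open>z = x * (1 - y * (x - z))\<close>, and the second factor is a small perturbation of
  1.\<close>

lemma open_has_inverse: "open {x :: 'b::complex_banach_algebra. has_inverse x}"
  unfolding open_dist
proof safe
  fix x :: 'b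
  assume inv: "has_inverse x"
  then obtain y where y: "x * y = 1" "y * x = 1"
    unfolding has_inverse_def by blast
  \<comment> \<open>The summand 1 in the denominator makes the radius positive without a lower bound
    on \<open>norm y\<close>.\<close>
  have "has_inverse z" if z: "dist z x < 1 / (norm y + 1)" for z
  proof -
    have "norm (y * (x - z)) \<le> norm y * norm (x - z)"
      by (rule norm_mult_ineq)
    also have "\<dots> \<le> (norm y + 1) * norm (x - z)"
      by (simp add: mult_right_mono)
    also have "\<dots> < 1"
      using z by (simp add: dist_norm norm_minus_commute field_simps add_pos_nonneg)
    finally have "has_inverse (x * (1 - y * (x - z)))"
      by (intro has_inverse_mult inv has_inverse_one_minus)
    moreover have "x * (1 - y * (x - z)) = z"
      using y by (simp add: right_diff_distrib flip: mult.assoc)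
    ultimately show ?thesis
      by simp
  qed
  moreover have "1 / (norm y + 1) > 0"
    by (simp add: add_nonneg_pos)
  ultimately show "\<exists>e>0. \<forall>z. dist z x < e \<longrightarrow> z \<in> {x. has_inverse x}"
    by blast
qed

text \<open>The resolvent identity expresses \<open>R d - R c\<close> as a product containing the
  factor \<open>d - c\<close>. It also contains \<open>R d\<close>, so \<open>R\<close> must first
  be shown to be bounded near \<open>c\<close>.\<close>

lemma continuous_on_resolvent:
  fixes a :: "'b::complex_banach_algebra"
  assumes left: "\<And>c. R c * (1 - c *\<^sub>C a) = 1" and right: "\<And>c. (1 - c *\<^sub>C a) * R c = 1"
  shows "continuous_on S R"
proof (rule continuous_at_imp_continuous_on, rule ballI)
  fix c
  define K where "K = norm a * norm (R c)"
  have diff: "R d - R c = R d * ((d - c) *\<^sub>C a) * R c" for d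
  proof -
    have "R d - R c = R d * ((1 - c *\<^sub>C a) * R c) - (R d * (1 - d *\<^sub>C a)) * R c"
      by (simp only: left right mult_1_left mult_1_right)
    also have "\<dots> = R d * ((d - c) *\<^sub>C a) * R c"
      by (simp add: scaleC_diff_left algebra_simps)
    finally show ?thesis .
  qed
  have bound: "norm (R d - R c) \<le> norm (R d) * (norm (d - c) * K)" for d
  proof -
    have "norm (R d - R c) \<le> norm (R d * ((d - c) *\<^sub>C a)) * norm (R c)"
      unfolding diff by (rule norm_mult_ineq)
    also have "\<dots> \<le> (norm (R d) * norm ((d - c) *\<^sub>C a)) * norm (R c)"
      by (intro mult_right_mono norm_mult_ineq norm_ge_zero)
    finally show ?thesis
      by (simp add: K_def norm_scaleC mult_ac)
  qed
  have lim: "(\<lambda>d. norm (d - c) * K) \<midarrow>c\<rightarrow> 0"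
    by (intro tendsto_eq_intros | simp)+
  have "R \<midarrow>c\<rightarrow> R c"
  proof (rule Lim_null[THEN iffD2], rule tendsto_0_le[OF lim])
    \<comment> \<open>Below 1/2, \<open>bound\<close> lets at most half of \<open>norm (R d)\<close>
      enter the triangle inequality, and absorbing it on the left yields
      \<open>norm (R d) \<le> 2 * norm (R c)\<close>.\<close>
    have "\<forall>\<^sub>F d in at c. norm (d - c) * K < 1 / 2"
      using lim by (rule order_tendstoD) simp
    then show "\<forall>\<^sub>F d in at c. norm (R d - R c) \<le> norm (norm (d - c) * K) * (2 * norm (R c))"
    proof eventually_elim
      case (elim d)
      have "norm (R d) \<le> norm (R c) + norm (R d - R c)"
        by (rule norm_triangle_sub)
      also have "\<dots> \<le> norm (R c) + norm (R d) * (1 / 2)"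
        using bound[of d] elim
        by (intro add_left_mono order_trans[OF bound] mult_left_mono) auto
      finally have "norm (R d) \<le> 2 * norm (R c)"
        by simp
      then have "norm (R d) * (norm (d - c) * K) \<le> (2 * norm (R c)) * (norm (d - c) * K)"
        by (intro mult_right_mono) (simp_all add: K_def)
      with bound[of d] show ?case
        by (simp add: K_def mult_ac)
    qed
  qed
  then show "isCont R c"
    by (simp add: isCont_def)
qed

section \<open>Averages of the resolvent over roots of unity\<close>

lemma sum_powers_of_root_of_unity:
  fixes w :: complex
  assumes "w ^ n = 1" "w \<noteq> 1"
  shows "(\<Sum>k<n. w ^ k) = 0"
  using assms geometric_sum[of w n] by simp

text \<open>Each summand times \<open>1 - (c *\<^sub>C a) ^ n\<close> is a finite geometric sum.
  Summed over all roots of unity, its terms of exponent \<open>j\<close> with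
  \<open>0 < j < n\<close> cancel, which leaves \<open>n\<close> copies of the unit.\<close>

lemma sum_resolvent_roots_of_unity:
  fixes a :: "'b::complex_banach_algebra" and n :: nat
  defines "\<omega> \<equiv> cis (2 * pi / n)"
  assumes left: "\<And>c. R c * (1 - c *\<^sub>C a) = 1" and "n > 0"
  shows "(\<Sum>k<n. R (\<omega> ^ k * c)) * (1 - (c *\<^sub>C a) ^ n) = of_nat n"
proof -
  have wn: "\<omega> ^ n = 1"
    using \<open>n > 0\<close> unfolding \<omega>_def Complex.DeMoivre by simp
  \<comment> \<open>\<open>\<omega>\<close> is a primitive root: \<open>\<omega> ^ j = 1\<close>
    would make \<open>j / n\<close> an integer.\<close>
  have w1: "\<omega> ^ j \<noteq> 1" if "0 < j" "j < n" for j
  proof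
    assume "\<omega> ^ j = 1"
    then have "cis (2 * pi * (real j / n)) = 1"
      unfolding \<omega>_def Complex.DeMoivre by (simp add: mult_ac)
    then obtain m :: int where "2 * pi * (real j / n) = 2 * pi * m"
      by (auto simp: complex_eq_iff cos_one_2pi_int mult_ac)
    then have "real j = of_int m * real n"
      using \<open>n > 0\<close> by (simp add: field_simps)
    then have "int j = m * int n"
      by (metis of_int_eq_iff of_int_mult of_int_of_nat_eq)
    then have "int n dvd int j"
      by simp
    with that show False
      by (simp add: nat_dvd_not_less)
  qed
  \<comment> \<open>Rotating \<open>c\<close> by \<open>\<omega> ^ k\<close> does not change the
    \<open>n\<close>-th power, so the same element \<open>1 - (c *\<^sub>C a) ^ n\<close> is
    divisible by \<open>1 - x\<close> for every \<open>k\<close>.\<close>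
  have summand: "R (\<omega> ^ k * c) * (1 - (c *\<^sub>C a) ^ n) = (\<Sum>j<n. (\<omega> ^ j) ^ k *\<^sub>C (c *\<^sub>C a) ^ j)" for k
  proof -
    define x where "x = (\<omega> ^ k * c) *\<^sub>C a"
    have pow: "x ^ j = (\<omega> ^ j) ^ k *\<^sub>C (c *\<^sub>C a) ^ j" for j
      by (simp add: x_def power_scaleC scaleC_scaleC power_mult_distrib mult.commute
          flip: power_mult)
    have "x ^ n = (c *\<^sub>C a) ^ n"
      using wn by (simp add: pow scaleC_one)
    then have "1 - (c *\<^sub>C a) ^ n = (1 - x) * (\<Sum>j<n. x ^ j)"
      using sum_lessThan_telescope'[of "\<lambda>j. x ^ j" n]
      by (simp add: sum_distrib_left left_diff_distrib)
    then have "R (\<omega> ^ k * c) * (1 - (c *\<^sub>C a) ^ n) = (\<Sum>j<n. x ^ j)"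
      using left[of "\<omega> ^ k * c"] by (simp add: x_def flip: mult.assoc)
    then show ?thesis
      by (simp add: pow)
  qed
  have "(\<Sum>k<n. R (\<omega> ^ k * c)) * (1 - (c *\<^sub>C a) ^ n)
      = (\<Sum>k<n. \<Sum>j<n. (\<omega> ^ j) ^ k *\<^sub>C (c *\<^sub>C a) ^ j)"
    by (simp add: sum_distrib_right summand)
  also have "\<dots> = (\<Sum>j<n. (\<Sum>k<n. (\<omega> ^ j) ^ k) *\<^sub>C (c *\<^sub>C a) ^ j)"
    unfolding scaleC_sum_left by (rule sum.swap)
  also have "\<dots> = (\<Sum>j<n. if j = 0 then of_nat n else 0)"
  proof (rule sum.cong)
    fix j assume "j \<in> {..<n}"
    moreover have "(\<omega> ^ j) ^ n = 1"
      using wn by (metis power_mult mult.commute power_one)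
    moreover have "(of_nat n :: complex) *\<^sub>C (1 :: 'b) = of_nat n"
      using scaleR_scaleC[of "real n" "1 :: 'b"] by (simp add: scaleR_conv_of_real)
    ultimately show "(\<Sum>k<n. (\<omega> ^ j) ^ k) *\<^sub>C (c *\<^sub>C a) ^ j = (if j = 0 then of_nat n else 0)"
      using w1[of j] by (auto simp: sum_powers_of_root_of_unity scaleC_zero_left)
  qed simp
  also have "\<dots> = of_nat n"
    using \<open>n > 0\<close> by simp
  finally show ?thesis .
qed

section \<open>The spectrum of a single element\<close>

lemma norm_mean_le:
  fixes f :: "nat \<Rightarrow> 'b::real_normed_vector"
  assumes "n > 0" "\<And>k. k < n \<Longrightarrow> norm (f k) \<le> B"
  shows "norm ((1 / real n) *\<^sub>R (\<Sum>k<n. f k)) \<le> B"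
proof -
  have "norm (\<Sum>k<n. f k) \<le> of_nat (card {..<n}) * B"
    using assms(2) by (intro sum_norm_bound) auto
  then show ?thesis
    using assms(1) by (simp add: field_simps)
qed

theorem spectrum_nonempty:
  fixes a :: "'b::complex_banach_algebra"
  shows "\<exists>c. \<not> has_inverse (a - c *\<^sub>C 1)"
proof (rule ccontr)
  assume "\<not> ?thesis"
  then have all_inv: "has_inverse (a - c *\<^sub>C 1)" for c
    by blast
  have "\<exists>y. y * (1 - c *\<^sub>C a) = 1 \<and> (1 - c *\<^sub>C a) * y = 1" for c
  proof (cases "c = 0")
    case True
    then show ?thesis
      by (intro exI[of _ 1]) (simp add: scaleC_zero_left)
  next
    case False
    \<comment> \<open>The hypothesis concerns \<open>a - c\<close>, the argument uses
      \<open>1 - c a\<close>; for nonzero \<open>c\<close> they are matched by inverting the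
      parameter.\<close>
    then have "1 - c *\<^sub>C a = (- c) *\<^sub>C (a - inverse c *\<^sub>C 1)"
      by (simp add: scaleC_minus_left scaleC_diff_right scaleC_scaleC scaleC_one)
    then have "has_inverse (1 - c *\<^sub>C a)"
      using all_inv False by (metis has_inverse_scaleC neg_equal_0_iff_equal)
    then show ?thesis
      unfolding has_inverse_def by blast
  qed
  then obtain R where left: "\<And>c. R c * (1 - c *\<^sub>C a) = 1" and right: "\<And>c. (1 - c *\<^sub>C a) * R c = 1"
    by metis
  obtain b where b: "a * b = 1" "b * a = 1"
    using all_inv[of 0] by (auto simp: has_inverse_def scaleC_zero_left)

  \<comment> \<open>In terms of the spectral radius, \<open>T\<close> consists of the
    \<open>r \<ge> 0\<close> whose product with the infimum of the \<open>n\<close>-th roots of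
    \<open>norm (a ^ n)\<close>, \<open>n > 0\<close>, is below 1.\<close>
  define T where "T = {r::real. 0 \<le> r \<and> (\<exists>n>0. norm ((of_real r *\<^sub>C a) ^ n) < 1)}"
  have norm_pow: "norm ((of_real r *\<^sub>C a) ^ n) = r ^ n * norm (a ^ n)" if "0 \<le> r" for r n
    using that by (simp add: power_scaleC norm_scaleC norm_power)
  have down: "s \<in> T" if "r \<in> T" "0 \<le> s" "s \<le> r" for r s
  proof -
    obtain n where n: "n > 0" "r ^ n * norm (a ^ n) < 1" "0 \<le> r"
      using \<open>r \<in> T\<close> norm_pow unfolding T_def by auto
    have "s ^ n * norm (a ^ n) \<le> r ^ n * norm (a ^ n)"
      using that by (intro mult_right_mono power_mono) auto
    with n that show ?thesis
      unfolding T_def by (auto simp: norm_pow intro!: exI[of _ n])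
  qed
  \<comment> \<open>The identity \<open>b ^ n * a ^ n = 1\<close> keeps
    \<open>norm b ^ n * norm (a ^ n)\<close> at least 1. As \<open>T\<close> is closed downwards, it
    is therefore bounded and has a supremum.\<close>
  have "norm b \<notin> T"
  proof
    assume "norm b \<in> T"
    then obtain n where n: "n > 0" "norm b ^ n * norm (a ^ n) < 1"
      using norm_pow unfolding T_def by auto
    have "b ^ m * a ^ m = 1" for m
    proof (induction m)
      case (Suc m)
      have "b ^ Suc m * a ^ Suc m = b ^ m * (b * a) * a ^ m"
        by (simp only: power_Suc2[of b] power_Suc[of a] mult.assoc)
      with Suc b show ?case
        by simp
    qed simp
    then have "1 \<le> norm (b ^ n * a ^ n)"
      using norm_one_ge_1 by metis
    also have "\<dots> \<le> norm (b ^ n) * norm (a ^ n)"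
      by (rule norm_mult_ineq)
    also have "\<dots> \<le> norm b ^ n * norm (a ^ n)"
      using n by (intro mult_right_mono norm_power_le) auto
    finally show False
      using n by simp
  qed
  then have bdd: "r < norm b" if "r \<in> T" for r
    using down[OF that, of "norm b"] by force
  have "0 \<in> T"
    unfolding T_def by (auto simp: scaleC_zero_left intro!: exI[of _ 1])
  define \<rho> where "\<rho> = Sup T"
  have bdd_above: "bdd_above T"
    using bdd by (auto intro!: bdd_aboveI less_imp_le)
  have upper: "r \<le> \<rho>" if "r \<in> T" for r
    using cSup_upper[OF that bdd_above] by (simp add: \<rho>_def)
  have "0 \<le> \<rho>"
    using \<open>0 \<in> T\<close> by (rule upper)

  define S where "S n r = (1 / real n) *\<^sub>R (\<Sum>k<n. R (cis (2 * pi / n) ^ k * of_real r))" for n r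
  \<comment> \<open>The left inverse \<open>S n r\<close> exists for every real \<open>r\<close>, in
    particular at \<open>\<rho>\<close>, where nothing is yet known about the size of the
    powers.\<close>
  have S: "S n r * (1 - (of_real r *\<^sub>C a) ^ n) = 1" if "n > 0" for n r
  proof -
    have "S n r * (1 - (of_real r *\<^sub>C a) ^ n) = (1 / real n) *\<^sub>R of_nat n"
      unfolding S_def mult_scaleR_left
      by (subst sum_resolvent_roots_of_unity[OF left that]) simp
    also have "(of_nat n :: 'b) = real n *\<^sub>R 1"
      by (simp add: scaleR_conv_of_real)
    finally show ?thesis
      using that by simp
  qed
  \<comment> \<open>All sample points lie in one compact disc, so that one modulus of continuity and
    one bound on \<open>R\<close> serve for all \<open>n\<close>.\<close>
  have in_disc: "cis (2 * pi / real n) ^ k * of_real r \<in> cball 0 \<rho>" if "0 \<le> r" "r \<le> \<rho>" for n k r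
    using that by (simp add: norm_mult norm_power)

  define K where "K = norm (1 :: 'b)"
  have "K > 0"
    using norm_one_ge_1[where 'b = 'b] by (simp add: K_def)
  \<comment> \<open>Chosen so that \<open>2 * e * (K + 1) = 1 / 2\<close>; this makes the final
    estimate for \<open>norm x\<close> strict.\<close>
  define e where "e = 1 / (4 * (K + 1))"
  have "e > 0"
    using \<open>K > 0\<close> by (simp add: e_def)
  have cont: "continuous_on (cball 0 \<rho>) R"
    using left right by (rule continuous_on_resolvent)
  then have "uniformly_continuous_on (cball 0 \<rho>) R"
    by (intro compact_uniformly_continuous) auto
  then obtain \<delta> where \<delta>: "\<delta> > 0"
      "\<And>x y. x \<in> cball 0 \<rho> \<Longrightarrow> y \<in> cball 0 \<rho> \<Longrightarrow> dist y x < \<delta> \<Longrightarrow> dist (R y) (R x) < e"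
    using \<open>e > 0\<close> unfolding uniformly_continuous_on_def by metis
  obtain r where r: "r \<in> T" "\<rho> - \<delta> < r"
    using less_cSupD[of T "\<rho> - \<delta>"] \<open>0 \<in> T\<close> \<delta>(1) by (auto simp: \<rho>_def)
  then have r_le: "0 \<le> r" "r \<le> \<rho>"
    using upper by (auto simp: T_def)

  \<comment> \<open>Corresponding sample points on the circles of radius \<open>\<rho>\<close> and
    \<open>r\<close> are \<open>\<rho> - r < \<delta>\<close> apart, whatever \<open>n\<close> and
    the angle are.\<close>
  have equi: "norm (S n \<rho> - S n r) \<le> e" if "n > 0" for n
  proof -
    have "norm (R (cis (2 * pi / n) ^ k * of_real \<rho>) - R (cis (2 * pi / n) ^ k * of_real r)) \<le> e" for k
    proof -
      have "dist (cis (2 * pi / n) ^ k * of_real \<rho>) (cis (2 * pi / n) ^ k * of_real r)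
          = norm (of_real (\<rho> - r) :: complex)"
        by (simp add: dist_norm norm_mult norm_power flip: right_diff_distrib of_real_diff)
      also have "\<dots> < \<delta>"
        unfolding norm_of_real using r r_le by simp
      finally show ?thesis
        using \<delta>(2)[OF in_disc[OF r_le] in_disc[OF \<open>0 \<le> \<rho>\<close> order_refl]]
        by (simp add: dist_norm less_imp_le)
    qed
    then have "norm ((1 / real n) *\<^sub>R (\<Sum>k<n. R (cis (2 * pi / n) ^ k * of_real \<rho>)
        - R (cis (2 * pi / n) ^ k * of_real r))) \<le> e"
      by (intro norm_mean_le that)
    then show ?thesis
      by (simp add: S_def sum_subtractf scaleR_diff_right)
  qed

  obtain B where B: "\<And>c. c \<in> cball 0 \<rho> \<Longrightarrow> norm (R c) \<le> B"
    using compact_imp_bounded[OF compact_continuous_image[OF cont compact_cball]]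
    unfolding bounded_iff by blast
  have S_bound: "norm (S n r) \<le> B" if "n > 0" for n
    unfolding S_def using that by (intro norm_mean_le B in_disc r_le)
  obtain m where "m > 0" "norm ((of_real r *\<^sub>C a) ^ m) < 1"
    using r(1) unfolding T_def by blast
  then have "(\<lambda>n. norm ((of_real r *\<^sub>C a) ^ n)) \<longlonglongrightarrow> 0"
    by (intro tendsto_norm_zero tendsto_power_zero_of_norm_power_less_1)
  then have "(\<lambda>n. B * norm ((of_real r *\<^sub>C a) ^ n)) \<longlonglongrightarrow> 0"
    by (rule tendsto_mult_right_zero)
  \<comment> \<open>Here \<open>r\<close> is already fixed; \<open>n\<close> can be taken this large
    because \<open>B\<close> and \<open>\<delta>\<close> were found independently of it.\<close>
  then have "\<forall>\<^sub>F n in sequentially. B * norm ((of_real r *\<^sub>C a) ^ n) < e \<and> n > 0"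
    using \<open>e > 0\<close> by (intro eventually_conj order_tendstoD eventually_gt_at_top)
  then obtain n where n: "B * norm ((of_real r *\<^sub>C a) ^ n) < e" "n > 0"
    using eventually_happens'[OF sequentially_bot] by blast

  have "norm (S n r - 1) < e"
  proof -
    have "S n r - 1 = S n r * (of_real r *\<^sub>C a) ^ n"
      using S[OF n(2), of r] by (simp add: right_diff_distrib diff_eq_eq add.commute)
    then have "norm (S n r - 1) \<le> norm (S n r) * norm ((of_real r *\<^sub>C a) ^ n)"
      by (simp add: norm_mult_ineq)
    also have "\<dots> \<le> B * norm ((of_real r *\<^sub>C a) ^ n)"
      using S_bound[OF n(2)] by (intro mult_right_mono) auto
    finally show ?thesis
      using n by simp
  qed
  then have close: "norm (1 - S n \<rho>) \<le> 2 * e"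
    using equi[OF n(2)] norm_triangle_ineq[of "S n \<rho> - S n r" "S n r - 1"]
    by (simp add: norm_minus_commute)
  define x where "x = (of_real \<rho> *\<^sub>C a) ^ n"
  \<comment> \<open>Since \<open>S n \<rho>\<close> is a left inverse of \<open>1 - x\<close> and
    close to 1, \<open>x\<close> is small: the estimate gives
    \<open>norm x * (1 - 2 * e) \<le> 2 * e * K\<close>, and the right side is less than the
    positive number \<open>1 - 2 * e\<close>.\<close>
  have "- x = (1 - S n \<rho>) * (1 - x)"
    using S[OF n(2), of \<rho>] by (simp add: x_def left_diff_distrib)
  then have "norm x \<le> norm (1 - S n \<rho>) * norm (1 - x)"
    by (metis norm_minus_cancel norm_mult_ineq)
  also have "\<dots> \<le> (2 * e) * (K + norm x)"
    using close \<open>e > 0\<close> norm_triangle_ineq4[of 1 x] by (intro mult_mono) (auto simp: K_def)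
  finally have "norm x * (1 - 2 * e) \<le> 2 * e * K"
    by (simp add: algebra_simps)
  moreover have "e * (K + 1) = 1 / 4"
    using \<open>K > 0\<close> by (simp add: e_def)
  then have "2 * e * K < 1 - 2 * e"
    by (simp add: distrib_left)
  moreover have "2 * e * K > 0"
    using \<open>e > 0\<close> \<open>K > 0\<close> by simp
  ultimately have "norm x < 1"
    by (smt (verit) mult_less_cancel_right2 mult_right_mono)
  then have less: "\<rho> ^ n * norm (a ^ n) < 1"
    using norm_pow[OF \<open>0 \<le> \<rho>\<close>] by (simp add: x_def)
  \<comment> \<open>With \<open>n\<close> fixed, the strict inequality at \<open>\<rho>\<close>
    persists slightly to the right by continuity, which puts a point beyond the supremum into
    \<open>T\<close>.\<close>
  have "((\<lambda>s. s ^ n * norm (a ^ n)) \<longlongrightarrow> \<rho> ^ n * norm (a ^ n)) (at_right \<rho>)"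
    by (intro tendsto_intros)
  then have "\<forall>\<^sub>F s in at_right \<rho>. s ^ n * norm (a ^ n) < 1 \<and> s > \<rho>"
    using less by (intro eventually_conj order_tendstoD eventually_at_right_less)
  then obtain s where "s ^ n * norm (a ^ n) < 1" "s > \<rho>"
    using eventually_happens'[OF trivial_limit_at_right_real] by blast
  then have "s \<in> T"
    using \<open>0 \<le> \<rho>\<close> n(2) norm_pow[of s n] by (auto simp: T_def)
  with \<open>s > \<rho>\<close> show False
    using upper by force
qed

section \<open>The pencil and its projective spectrum\<close>

lemma continuous_on_linear_pencil: "continuous_on S (linear_pencil A)"
  unfolding linear_pencil_def
  by (intro continuous_on_sum bounded_linear.continuous_on[OF bounded_linear_scaleC_left]
      continuous_intros)

text \<open>Restricts the pencil to two coordinates, where invertibility becomes a question about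
  the spectrum of one element.\<close>

lemma linear_pencil_axis_diff:
  "linear_pencil A (axis j 1 - c *s axis i 1) = A $ j - c *\<^sub>C A $ i"
proof -
  have "linear_pencil A (axis j 1 - c *s axis i 1) =
      (\<Sum>k\<in>UNIV. (if k = j then A $ j else 0) - (if k = i then c *\<^sub>C A $ i else 0))"
    unfolding linear_pencil_def
    by (intro sum.cong)
      (auto simp: axis_def scaleC_zero_left scaleC_minus_left scaleC_diff_left scaleC_one)
  then show ?thesis
    by (simp add: sum_subtractf)
qed

text \<open>If \<open>A $ i\<close> has inverse \<open>b\<close>, a spectral value \<open>c\<close>
  of \<open>b * A $ j\<close> makes \<open>A $ j - c *\<^sub>C A $ i\<close> singular, since
  \<open>b\<close> times it is \<open>b * A $ j - c *\<^sub>C 1\<close>. Two distinct indices ensure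
  that the coefficient vector is nonzero.\<close>

lemma projective_spectrum_nonempty:
  fixes A :: "'b::complex_banach_algebra ^ 'm"
  assumes "CARD('m) \<ge> 2"
  shows "projective_spectrum A \<noteq> {}"
proof
  assume "projective_spectrum A = {}"
  then have inv: "has_inverse (linear_pencil A z)" if "z \<noteq> 0" for z
    using that unfolding projective_spectrum_def by blast
  have "\<not> CARD('m) \<le> Suc 0"
    using assms by simp
  then obtain i j :: 'm where "i \<noteq> j"
    by (auto simp: card_le_Suc0_iff_eq)
  \<comment> \<open>The instance with \<open>j\<close> replaced by \<open>i\<close> and coefficient
    0 evaluates the pencil at \<open>axis i 1\<close>.\<close>
  have "has_inverse (A $ i)"
    using inv[of "axis i 1"] linear_pencil_axis_diff[of A i 0]
    by (simp add: scaleC_zero_left)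
  then obtain b where b: "A $ i * b = 1" "b * A $ i = 1"
    unfolding has_inverse_def by blast
  then have "has_inverse b"
    unfolding has_inverse_def by blast
  obtain c where c: "\<not> has_inverse (b * A $ j - c *\<^sub>C 1)"
    using spectrum_nonempty by blast
  have "(axis j 1 - c *s axis i 1 :: complex ^ 'm) $ j = 1"
    using \<open>i \<noteq> j\<close> by (simp add: axis_def)
  then have "axis j 1 - c *s axis i 1 \<noteq> (0 :: complex ^ 'm)"
    by (metis zero_index zero_neq_one)
  then have "has_inverse (b * (A $ j - c *\<^sub>C A $ i))"
    using inv \<open>has_inverse b\<close> by (metis has_inverse_mult linear_pencil_axis_diff)
  also have "b * (A $ j - c *\<^sub>C A $ i) = b * A $ j - c *\<^sub>C 1"
    using b by (simp add: right_diff_distrib mult_scaleC_right)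
  finally show False
    using c by blast
qed

text \<open>Every class has a representative of norm 1, so the compact set of singular unit vectors
  already maps onto the spectrum under the continuous quotient map. The closed set \<open>N\<close>
  itself contains 0, which the sphere excludes.\<close>

lemma compact_projective_spectrum:
  fixes A :: "'b::complex_banach_algebra ^ 'm"
  shows "compact (projective_spectrum A)"
proof -
  define N where "N = {z :: complex ^ 'm. \<not> has_inverse (linear_pencil A z)}"
  have "closed ((linear_pencil A) -` (- {x. has_inverse x}))"
    using open_has_inverse[where 'b = 'b] continuous_on_linear_pencil[of UNIV A]
    by (intro continuous_closed_vimage) (auto simp: continuous_on_eq_continuous_at closed_Compl)
  also have "(linear_pencil A) -` (- {x. has_inverse x}) = N"
    by (auto simp: N_def)
  finally have "compact (sphere 0 1 \<inter> N)"
    by (intro compact_Int_closed) auto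
  moreover have "continuous_on (- {0}) (proj_class :: complex ^ 'm \<Rightarrow> _)"
    using quotient_imp_continuous_map[OF quotient_map_proj_class]
    by (simp only: continuous_map_iff_continuous)
  then have "continuous_on (sphere 0 1 \<inter> N) proj_class"
    by (rule continuous_on_subset) auto
  ultimately have "compact (proj_class ` (sphere 0 1 \<inter> N))"
    using compact_continuous_image by blast
  moreover have "projective_spectrum A = proj_class ` (sphere 0 1 \<inter> N)"
  proof (intro equalityI subsetI)
    fix p assume "p \<in> projective_spectrum A"
    then obtain z where z: "z \<noteq> 0" "p = proj_class z" "p \<in> projective_spectrum A"
      unfolding projective_spectrum_def by blast
    define c :: complex where "c = of_real (inverse (norm z))"
    have "c \<noteq> 0"
      using z by (simp add: c_def)
    have "c *s z = inverse (norm z) *\<^sub>R z"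
      by (simp add: vec_eq_iff c_def scaleR_conv_of_real[where 'a = complex])
    then have unit: "norm (c *s z) = 1"
      using z by simp
    then have nz: "c *s z \<noteq> 0"
      by (metis norm_zero zero_neq_one)
    then have eq: "p = proj_class (c *s z)"
      using proj_class_eq_iff[OF z(1) nz] \<open>c \<noteq> 0\<close> z by blast
    then have "c *s z \<in> sphere 0 1 \<inter> N"
      using z(3) proj_class_in_projective_spectrum_iff[OF nz, of A] unit by (simp add: N_def)
    with eq show "p \<in> proj_class ` (sphere 0 1 \<inter> N)"
      by blast
  next
    fix p assume "p \<in> proj_class ` (sphere 0 1 \<inter> N)"
    then obtain z where "norm z = 1" "\<not> has_inverse (linear_pencil A z)" "p = proj_class z"
      by (auto simp: N_def)
    moreover from this(1) have "z \<noteq> 0"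
      by auto
    ultimately show "p \<in> projective_spectrum A"
      unfolding projective_spectrum_def by blast
  qed
  ultimately show ?thesis
    by simp
qed

theorem proposition1p1:
  fixes A :: "'b::complex_banach_algebra ^ 'm" and n :: nat
  assumes "n \<ge> 1" and "CARD('m) = n + 1"
  shows "projective_spectrum A \<noteq> {} \<and> compact (projective_spectrum A)"
  using assms by (simp add: projective_spectrum_nonempty compact_projective_spectrum)

end
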